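(* Let $R$ be a local ring and let $I$ be a weakly $1$-absorbing prime ideal of $R$ that is not a $1$-absorbing prime ideal. Then $I^3 = 0$.
   Context: All rings are commutative with identity. A ring is called local if it has a unique maximal ideal. A proper ideal $I$ of a ring $R$ (i.e. $I\neq R$) is called $1$-absorbing prime if for all nonunit elements $a,b,c\in R$ with $abc\in I$, either $ab\in I$ or $c\in I$. A proper ideal $I$ of $R$ is called weakly $1$-absorbing prime if for all nonunit elements $a,b,c\in R$ with $0\neq abc\in I$, either $ab\in I$ or $c\in I$. *)

theory Defs
  imports "HOL-Algebra.Ideal_Product"
begin

locale local_ring = cring +
  assumes unique_maximalideal: "\<exists>!M. maximalideal M R"

locale one_absorbing_primeideal = ideal + cring +
  assumes I_notcarr: "carrier R \<noteq> I"
    and I_one_absorbing: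
      "\<lbrakk>a \<in> carrier R - Units R; b \<in> carrier R - Units R; c \<in> carrier R - Units R;
        a \<otimes> b \<otimes> c \<in> I\<rbrakk> \<Longrightarrow> a \<otimes> b \<in> I \<or> c \<in> I"

locale weakly_one_absorbing_primeideal = ideal + cring +
  assumes I_notcarr: "carrier R \<noteq> I"
    and I_weakly_one_absorbing:
      "\<lbrakk>a \<in> carrier R - Units R; b \<in> carrier R - Units R; c \<in> carrier R - Units R;
        a \<otimes> b \<otimes> c \<noteq> \<zero>; a \<otimes> b \<otimes> c \<in> I\<rbrakk> \<Longrightarrow> a \<otimes> b \<in> I \<or> c \<in> I"

end

theory Submission
  imports Defs "HOL-Algebra.Ring_Divisibility"
begin

text \<open>
  If $I$ is not $1$-absorbing prime, there are nonunits $a, b, c$ with $abc = 0$, $ab \notin I$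
  and $c \notin I$. Since $R$ is local, translating each of them by elements $x, y, z$ of $I$
  gives nonunits again, and the translated triple still violates the $1$-absorbing condition;
  hence $(a + x)(b + y)(c + z) = 0$. Taking differences of these identities in one variable
  at a time yields $xyz = 0$.
\<close>

lemma (in ideal) proper_imp_nonunit:
  assumes "I \<noteq> carrier R" and "x \<in> I"
  shows "x \<in> carrier R - Units R"
proof -
  have "\<one> \<in> I" if "x \<in> Units R"
    using I_l_closed[OF \<open>x \<in> I\<close> Units_inv_closed[OF that]] that by simp
  then show ?thesis
    using assms one_imp_carrier Icarr by blast
qed

lemma (in ideal) mem_of_add_mem:
  assumes "a \<in> carrier R" and "x \<in> I" and "a \<oplus> x \<in> I"
  shows "a \<in> I"
proof -
  have "(a \<oplus> x) \<oplus> \<ominus> x \<in> I"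
    using assms by (simp add: a_closed a_inv_closed)
  moreover have "(a \<oplus> x) \<oplus> \<ominus> x = a"
    using assms(1) Icarr[OF assms(2)] by (simp add: add.m_assoc r_neg)
  ultimately show ?thesis by simp
qed

lemma (in ring) exists_maximalideal_superset:
  assumes "ideal J R" and "J \<noteq> carrier R"
  shows "\<exists>M. maximalideal M R \<and> J \<subseteq> M"
proof -
  \<comment> \<open>Properness is encoded as \<open>\<one> \<notin> K\<close>, a condition that
    visibly passes to the union of a chain, as Zorn's lemma requires.\<close>
  define S where "S = {K. ideal K R \<and> J \<subseteq> K \<and> \<one> \<notin> K}"
  have "\<exists>M\<in>S. \<forall>K\<in>S. M \<subseteq> K \<longrightarrow> K = M"
  proof (rule subset_Zorn_nonempty)
    show "S \<noteq> {}"
      using assms ideal.one_imp_carrier by (auto simp: S_def)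
  next
    fix C assume "C \<noteq> {}" and C: "subset.chain S C"
    then have "ideal (\<Union>C) R"
      using chain_Union_is_ideal[of C] by (auto simp: subset_chain_def S_def)
    with \<open>C \<noteq> {}\<close> C show "\<Union>C \<in> S"
      by (auto simp: subset_chain_def S_def)
  qed
  then obtain M where M: "M \<in> S" and max: "\<And>K. \<lbrakk>K \<in> S; M \<subseteq> K\<rbrakk> \<Longrightarrow> K = M"
    by blast
  have "maximalideal M R"
  proof (rule maximalidealI)
    show "ideal M R" "carrier R \<noteq> M"
      using M by (auto simp: S_def)
    show "K = M \<or> K = carrier R" if "ideal K R" "M \<subseteq> K" "K \<subseteq> carrier R" for K
      using M max[of K] that ideal.one_imp_carrier[OF that(1)] by (auto simp: S_def)
  qed
  with M show ?thesis by (auto simp: S_def)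
qed

lemma (in cring) nonunit_in_maximalideal:
  assumes "a \<in> carrier R - Units R"
  shows "\<exists>M. maximalideal M R \<and> a \<in> M"
proof -
  have "\<one> \<notin> PIdl a"
  proof
    assume "\<one> \<in> PIdl a"
    then obtain r where "r \<in> carrier R" "\<one> = r \<otimes> a"
      by (auto simp: cgenideal_def)
    with assms show False
      by (auto simp: Units_def m_comm)
  qed
  with assms show ?thesis
    using exists_maximalideal_superset[of "PIdl a"] cgenideal_ideal[of a] cgenideal_self[of a]
    by (metis DiffD1 one_closed subsetD)
qed

text \<open>This is where locality enters. Every nonunit and every proper ideal lie in some maximal
  ideal; as there is only one, it contains both \<open>a\<close> and \<open>x\<close>, hence their
  sum, and its elements are nonunits.\<close>

lemma (in local_ring) nonunit_add_proper:
  assumes I: "ideal I R" "I \<noteq> carrier R" and a: "a \<in> carrier R - Units R" and x: "x \<in> I"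
  shows "a \<oplus> x \<in> carrier R - Units R"
proof -
  obtain M where M: "maximalideal M R" and "I \<subseteq> M"
    using exists_maximalideal_superset[OF I] by blast
  interpret M: maximalideal M R by (fact M)
  have "a \<in> M"
    using nonunit_in_maximalideal[OF a] M unique_maximalideal by blast
  then have "a \<oplus> x \<in> M"
    using \<open>I \<subseteq> M\<close> x by blast
  then show ?thesis
    using M.proper_imp_nonunit M.I_notcarr by blast
qed

lemma (in ring) ideal_prod_subset:
  assumes "ideal K R" and "\<And>i j. \<lbrakk>i \<in> I; j \<in> J\<rbrakk> \<Longrightarrow> i \<otimes> j \<in> K"
  shows "I \<cdot> J \<subseteq> K"
proof
  fix s assume "s \<in> I \<cdot> J"
  then show "s \<in> K"
    by induct (use assms additive_subgroup.a_closed[OF ideal.axioms(1)] in auto)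
qed

text \<open>An ideal product consists of finite sums of products, so vanishing on triples of
  elements suffices. The induction treats \<open>I \<cdot> J\<close> with \<open>z\<close> fixed;
  the outer product then follows from its generators.\<close>

lemma (in cring) triple_ideal_prod_eq_zero:
  assumes I: "ideal I R" "ideal J R" "ideal K R"
    and zero: "\<And>x y z. \<lbrakk>x \<in> I; y \<in> J; z \<in> K\<rbrakk> \<Longrightarrow> x \<otimes> y \<otimes> z = \<zero>"
  shows "I \<cdot> J \<cdot> K = {\<zero>}"
proof
  show "{\<zero>} \<subseteq> I \<cdot> J \<cdot> K"
    using ideal_prod_is_ideal[OF ideal_prod_is_ideal[OF I(1,2)] I(3)]
    by (simp add: additive_subgroup.zero_closed ideal.axioms(1))
  have "s \<otimes> z = \<zero>" if "s \<in> I \<cdot> J" "z \<in> K" for s z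
    using that(1)
  proof induct
    case (prod i j)
    with zero that(2) show ?case by blast
  next
    case (sum s t)
    then show ?case
      using ideal_prod_in_carrier[OF I(1,2)] ideal.Icarr[OF I(3) that(2)]
      by (simp add: l_distr subset_iff)
  qed
  then show "I \<cdot> J \<cdot> K \<subseteq> {\<zero>}"
    by (intro ideal_prod_subset zeroideal) auto
qed

lemma (in cring) triple_prod_zero_by_translation:
  assumes I: "ideal I R" and carr: "a \<in> carrier R" "b \<in> carrier R" "c \<in> carrier R"
    and zero: "\<And>x y z. \<lbrakk>x \<in> I; y \<in> I; z \<in> I\<rbrakk> \<Longrightarrow> (a \<oplus> x) \<otimes> (b \<oplus> y) \<otimes> (c \<oplus> z) = \<zero>"
    and xyz: "x \<in> I" "y \<in> I" "z \<in> I"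
  shows "x \<otimes> y \<otimes> z = \<zero>"
proof -
  interpret ideal I R by (fact I)
  \<comment> \<open>Each round uses that the product is affine in one variable: subtracting its
    value at zero turns \<open>a \<oplus> x\<close> into \<open>x\<close>. The second instance of
    \<open>zero\<close> is that value.\<close>
  have 1: "x \<otimes> (b \<oplus> v) \<otimes> (c \<oplus> w) = \<zero>" if "v \<in> I" "w \<in> I" for v w
    using zero[OF xyz(1) that] zero[OF zero_closed that] that xyz(1) carr Icarr
    by (simp add: l_distr)
  have 2: "x \<otimes> y \<otimes> (c \<oplus> w) = \<zero>" if "w \<in> I" for w
  proof -
    \<comment> \<open>Naming the last factor keeps it from being expanded, so that distributivity
      splits only \<open>b \<oplus> y\<close> and the term \<open>x \<otimes> b \<otimes> t\<close>
      cancels by the instance at zero.\<close>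
    define t where "t = c \<oplus> w"
    have "t \<in> carrier R"
      unfolding t_def using carr Icarr[OF that] by simp
    then show ?thesis
      using 1[OF xyz(2) that] 1[OF zero_closed that] xyz carr Icarr
      unfolding t_def[symmetric] by (simp add: l_distr r_distr)
  qed
  show ?thesis
    using 2[OF xyz(3)] 2[OF zero_closed] xyz carr Icarr
    by (simp add: r_distr)
qed

lemma (in weakly_one_absorbing_primeideal) cube_eq_zero:
  assumes "local_ring R" and "\<not> one_absorbing_primeideal I R"
  shows "I \<cdot> I \<cdot> I = {\<zero>}"
proof -
  interpret local_ring R by (fact assms(1))
  have I: "ideal I R" "I \<noteq> carrier R"
    using ideal_axioms I_notcarr by auto
  \<comment> \<open>Since \<open>I\<close> is proper, failing to be 1-absorbing prime yields a
    violating triple. That \<open>a \<otimes> b \<otimes> c\<close> vanishes is the case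
    \<open>x = y = z = \<zero>\<close> of the next claim.\<close>
  obtain a b c where nonunit: "a \<in> carrier R - Units R" "b \<in> carrier R - Units R"
      "c \<in> carrier R - Units R"
    and abc: "a \<otimes> b \<otimes> c \<in> I" and ab: "a \<otimes> b \<notin> I" and c: "c \<notin> I"
    using assms(2) I_notcarr
    by (auto simp: one_absorbing_primeideal_def one_absorbing_primeideal_axioms_def
        ideal_axioms cring_axioms)
  then have carr: "a \<in> carrier R" "b \<in> carrier R" "c \<in> carrier R" by auto
  have zero: "(a \<oplus> x) \<otimes> (b \<oplus> y) \<otimes> (c \<oplus> z) = \<zero>" if xyz: "x \<in> I" "y \<in> I" "z \<in> I" for x y z
  proof -
    have xyz_carr: "x \<in> carrier R" "y \<in> carrier R" "z \<in> carrier R"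
      using xyz Icarr by auto
    \<comment> \<open>\<open>u\<close> is the change in \<open>a \<otimes> b\<close> under
      translation, grouped so that each summand has a factor in \<open>I\<close>. Hence the
      translated product is congruent to \<open>a \<otimes> b\<close> modulo \<open>I\<close> and
      stays outside \<open>I\<close>.\<close>
    define u where "u = a \<otimes> y \<oplus> x \<otimes> (b \<oplus> y)"
    have u: "u \<in> I"
      unfolding u_def using xyz carr xyz_carr by (simp add: I_l_closed I_r_closed)
    have prod2: "(a \<oplus> x) \<otimes> (b \<oplus> y) = a \<otimes> b \<oplus> u"
      unfolding u_def using carr xyz_carr by (simp add: l_distr r_distr a_ac)
    have not_ab: "(a \<oplus> x) \<otimes> (b \<oplus> y) \<notin> I"
      unfolding prod2 using mem_of_add_mem[OF _ u] ab carr by blast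
    have not_c: "c \<oplus> z \<notin> I"
      using mem_of_add_mem[OF carr(3) xyz(3)] c by blast
    have "(a \<oplus> x) \<otimes> (b \<oplus> y) \<otimes> (c \<oplus> z) = a \<otimes> b \<otimes> c \<oplus> (a \<otimes> b \<otimes> z \<oplus> u \<otimes> (c \<oplus> z))"
      unfolding prod2 using carr xyz_carr Icarr[OF u] by (simp add: l_distr r_distr a_ac)
    also have "\<dots> \<in> I"
      using abc u xyz carr xyz_carr by (simp add: I_l_closed I_r_closed)
    \<comment> \<open>Were the product nonzero, the weak condition would put
      \<open>(a \<oplus> x) \<otimes> (b \<oplus> y)\<close> or \<open>c \<oplus> z\<close> into
      \<open>I\<close>; both are excluded.\<close>
    finally show ?thesis
      using I_weakly_one_absorbing[of "a \<oplus> x" "b \<oplus> y" "c \<oplus> z"] not_ab not_c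
        nonunit_add_proper[OF I] nonunit xyz by blast
  qed
  show ?thesis
    using triple_ideal_prod_eq_zero[OF I(1) I(1) I(1)]
      triple_prod_zero_by_translation[OF I(1) carr zero] by blast
qed

theorem theorem2p6:
  fixes R :: "('a, 'b) ring_scheme" and I :: "'a set"
  assumes "local_ring R"
    and "weakly_one_absorbing_primeideal I R"
    and "\<not> one_absorbing_primeideal I R"
  shows "I \<cdot>\<^bsub>R\<^esub> I \<cdot>\<^bsub>R\<^esub> I = {\<zero>\<^bsub>R\<^esub>}"
  using assms weakly_one_absorbing_primeideal.cube_eq_zero by blast

end
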